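(* Let $n\ge 1$ and let $Q\in\mathbb{R}^{n\times n}$ be a Stieltjes matrix. The inequalities $$W\le \sum_{k=1}^n R(\pi_k;S_{k-1}^\pi)\,z_{\pi_k}\qquad\text{(entrywise), for all permutations }\pi=(\pi_1,\dots,\pi_n)\text{ of }[n],$$ together with the bound constraints $0\le z\le e$ describe $\operatorname{conv}(P_Q^{\le})$; that is, $\operatorname{conv}(P_Q^{\le})$ is equal to the set of all $(z,W)\in\mathbb{R}^n\times\mathbb{R}^{n\times n}$ satisfying all of these inequalities.
   Context: Write $[n]=\{1,\dots,n\}$ and let $e$ be the all-ones vector in $\mathbb{R}^n$. A Stieltjes matrix is a symmetric positive definite matrix $Q\in\mathbb{R}^{n\times n}$ with $Q_{ij}\le 0$ for all $i\ne j$. For $S\subseteq[n]$, $e_S\in\{0,1\}^n$ is the indicator vector of $S$, and $Q_S^\star:=(Q\circ e_Se_S^\top)^\dagger\in\mathbb{R}^{n\times n}$, where $\circ$ is the entrywise product and $\dagger$ the Moore–Penrose pseudoinverse; equivalently, $Q_S^\star$ has $S\times S$ block equal to the inverse of the principal submatrix of $Q$ indexed by $S$ and all other entries $0$ (with $Q_\emptyset^\star=0$). For $S\subseteq[n]$ and $k\in[n]\setminus S$, let $R(k;S):=Q_{S\cup\{k\}}^\star-Q_S^\star\in\mathbb{R}^{n\times n}$. For a permutation $\pi=(\pi_1,\dots,\pi_n)$ of $[n]$, let $S_0^\pi=\emptyset$ and $S_k^\pi=\{\pi_1,\dots,\pi_k\}$ for $k\in[n]$. Let $$P_Q^{\le}=\{(z,W)\in\{0,1\}^n\times\mathbb{R}^{n\times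 n}: W\le (Q\circ zz^\top)^\dagger\}$$ with $\le$ entrywise ($W$ is not required to be symmetric). *)

theory Defs
  imports "HOL-Analysis.Analysis"
begin

text \<open>
  The ground set \<open>[n]\<close> is the universe of a finite index type \<open>'n\<close> with \<open>n = CARD('n)\<close> (so
  \<open>n \<ge> 1\<close>). The order \<open>\<le>\<close> on \<^typ>\<open>real ^ 'n ^ 'n\<close> is the library's componentwise one, i.e.
  entrywise comparison, not the Loewner order. Likewise \<open>*\<close> on this type is the entrywise
  (Hadamard) product; the matrix product is \<open>**\<close>.
\<close>

definition stieltjes_matrix :: "real ^ 'n ^ 'n \<Rightarrow> bool" where
  "stieltjes_matrix Q \<longleftrightarrow>
     transpose Q = Q \<and> (\<forall>x. x \<noteq> 0 \<longrightarrow> 0 < x \<bullet> (Q *v x)) \<and>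
     (\<forall>i j. i \<noteq> j \<longrightarrow> Q $ i $ j \<le> 0)"

definition outer_product :: "real ^ 'n \<Rightarrow> real ^ 'm \<Rightarrow> real ^ 'm ^ 'n" where
  "outer_product x y = (\<chi> i j. x $ i * y $ j)"

definition ind_vec :: "'n set \<Rightarrow> real ^ 'n" where
  "ind_vec S = (\<chi> i. if i \<in> S then 1 else 0)"

definition is_pseudoinverse :: "real ^ 'm ^ 'n \<Rightarrow> real ^ 'n ^ 'm \<Rightarrow> bool" where
  "is_pseudoinverse A X \<longleftrightarrow>
     A ** X ** A = A \<and> X ** A ** X = X \<and>
     transpose (A ** X) = A ** X \<and> transpose (X ** A) = X ** A"

definition pseudoinverse :: "real ^ 'm ^ 'n \<Rightarrow> real ^ 'n ^ 'm" where
  "pseudoinverse A = (THE X. is_pseudoinverse A X)"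

lemma is_pseudoinverse_unique:
  fixes A :: "real ^ 'm ^ 'n"
  assumes X: "is_pseudoinverse A X" and Y: "is_pseudoinverse A Y"
  shows "X = Y"
proof -
  have AX: "A ** X = A ** Y"
  proof -
    have "A ** X = transpose ((A ** Y) ** (A ** X))"
      using X Y unfolding is_pseudoinverse_def
      by (metis matrix_mul_assoc)
    also have "\<dots> = (A ** X) ** (A ** Y)"
      using X Y unfolding is_pseudoinverse_def by (simp only: matrix_transpose_mul)
    also have "\<dots> = A ** Y"
      using X unfolding is_pseudoinverse_def by (metis matrix_mul_assoc)
    finally show ?thesis .
  qed
  have XA: "X ** A = Y ** A"
  proof -
    have "X ** A = transpose ((X ** A) ** (Y ** A))"
      using X Y unfolding is_pseudoinverse_def by (metis matrix_mul_assoc)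
    also have "\<dots> = (Y ** A) ** (X ** A)"
      using X Y unfolding is_pseudoinverse_def by (simp only: matrix_transpose_mul)
    also have "\<dots> = Y ** A"
      using X unfolding is_pseudoinverse_def by (metis matrix_mul_assoc)
    finally show ?thesis .
  qed
  have "X = X ** (A ** X)"
    using X unfolding is_pseudoinverse_def by (simp add: matrix_mul_assoc)
  also have "\<dots> = Y ** A ** Y"
    by (simp add: AX XA matrix_mul_assoc)
  also have "\<dots> = Y"
    using Y unfolding is_pseudoinverse_def by simp
  finally show ?thesis .
qed

lemma pseudoinverse_eqI: "is_pseudoinverse A X \<Longrightarrow> pseudoinverse A = X"
  unfolding pseudoinverse_def using is_pseudoinverse_unique by blast

definition Qstar :: "real ^ 'n ^ 'n \<Rightarrow> 'n set \<Rightarrow> real ^ 'n ^ 'n" where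
  "Qstar Q S = pseudoinverse (Q * outer_product (ind_vec S) (ind_vec S))"

definition R_mat :: "real ^ 'n ^ 'n \<Rightarrow> 'n \<Rightarrow> 'n set \<Rightarrow> real ^ 'n ^ 'n" where
  "R_mat Q k S = Qstar Q (insert k S) - Qstar Q S"

definition P_le :: "real ^ 'n ^ 'n \<Rightarrow> ((real ^ 'n) \<times> (real ^ 'n ^ 'n)) set" where
  "P_le Q = {(z, W). (\<forall>i. z $ i \<in> {0, 1}) \<and> W \<le> pseudoinverse (Q * outer_product z z)}"

text \<open>A permutation \<open>(\<pi>\<^sub>1, \<dots>, \<pi>\<^sub>n)\<close> is a map whose restriction to \<open>{1..n}\<close> is a bijection onto
  the index type; values outside \<open>{1..n}\<close> are irrelevant.\<close>

definition is_ordering :: "(nat \<Rightarrow> 'n::finite) \<Rightarrow> bool" where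
  "is_ordering \<pi> \<longleftrightarrow> bij_betw \<pi> {1..CARD('n)} UNIV"

definition prefix_set :: "(nat \<Rightarrow> 'n) \<Rightarrow> nat \<Rightarrow> 'n set" where
  "prefix_set \<pi> k = \<pi> ` {1..k}"

end

theory Submission
  imports Defs
begin

text \<open>
  Bordering the inverse of a principal submatrix by one index \<open>k\<close> is a rank one update
  \<open>R(k;S) = v v\<^sup>T / s\<close>, where \<open>v = e\<^sub>k - Q\<^sub>S\<^sup>\<star> Q e\<^sub>k\<close> and \<open>s\<close> is the Schur complement. Since the
  off-diagonal entries of \<open>Q\<close> are nonpositive, \<open>v\<close> is nonnegative and grows with \<open>Q\<^sub>S\<^sup>\<star>\<close>, while
  \<open>s > 0\<close> shrinks. By induction \<open>Q\<^sub>S\<^sup>\<star>\<close> is nonnegative and increasing in \<open>S\<close>, and therefore so is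
  \<open>R(k;S)\<close>: each entry of \<open>Q\<^sub>S\<^sup>\<star>\<close> is a supermodular set function. Validity of the inequalities is
  then telescoping along \<open>\<pi>\<close>. Conversely the ordering that sorts \<open>z\<close> decreasingly serves all
  entries simultaneously, and Abel summation writes a point of the polyhedron as a convex
  combination of the points belonging to the prefixes of that ordering.
\<close>

section \<open>Inverses of principal submatrices\<close>

text \<open>The inverse of the \<open>S\<close> block of \<open>Q\<close> padded with zeros, phrased
  with full-size matrices. Since \<open>X\<close> vanishes outside \<open>S\<close>, the full
  \<open>Q\<close> can stand in \<open>Q ** X\<close> in place of its mask, provided only the rows
  in \<open>S\<close> are prescribed.\<close>

definition block_inverse :: "real ^ 'n ^ 'n \<Rightarrow> 'n set \<Rightarrow> real ^ 'n ^ 'n \<Rightarrow> bool" where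
  "block_inverse Q S X \<longleftrightarrow>
     transpose X = X \<and> (\<forall>i j. i \<notin> S \<longrightarrow> X $ i $ j = 0) \<and>
     (\<forall>i\<in>S. \<forall>j. (Q ** X) $ i $ j = (if i = j then 1 else 0))"

lemma symmetric_entry: "transpose A = A \<Longrightarrow> A $ i $ j = A $ j $ i"
  by (metis transpose_def vec_lambda_beta)

lemma block_inverse_outside:
  assumes "block_inverse Q S X" "i \<notin> S \<or> j \<notin> S"
  shows "X $ i $ j = 0"
  using assms symmetric_entry[of X i j] unfolding block_inverse_def by auto

lemma masked_mult_block_inverse:
  assumes "block_inverse Q S X"
  shows "(Q * outer_product (ind_vec S) (ind_vec S)) ** X =
         (\<chi> i j. if i \<in> S \<and> i = j then 1 else 0)"
proof -
  have "((Q * outer_product (ind_vec S) (ind_vec S)) ** X) $ i $ j =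
        (if i \<in> S then (Q ** X) $ i $ j else 0)" for i j
    using block_inverse_outside[OF assms]
    by (auto simp: matrix_matrix_mult_def outer_product_def ind_vec_def intro!: sum.cong)
  then show ?thesis
    using assms by (auto simp: vec_eq_iff block_inverse_def)
qed

text \<open>By transposition both products of the masked matrix and \<open>X\<close> equal the
  diagonal projection onto \<open>S\<close>. It fixes from the left every matrix whose rows outside
  \<open>S\<close> are zero, and the four Penrose equations follow.\<close>

lemma block_inverse_is_pseudoinverse:
  assumes X: "block_inverse Q S X" and sym: "transpose Q = Q"
  shows "is_pseudoinverse (Q * outer_product (ind_vec S) (ind_vec S)) X"
proof -
  define A where "A = Q * outer_product (ind_vec S) (ind_vec S)"
  define P :: "real ^ 'a ^ 'a" where "P = (\<chi> i j. if i \<in> S \<and> i = j then 1 else 0)"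
  have AX: "A ** X = P"
    using masked_mult_block_inverse[OF X] by (simp add: A_def P_def)
  have tP: "transpose P = P"
    by (auto simp: P_def transpose_def vec_eq_iff)
  have tA: "transpose A = A"
    using symmetric_entry[OF sym]
    by (auto simp: A_def transpose_def vec_eq_iff outer_product_def)
  have XA: "X ** A = P"
    using arg_cong[OF AX, of transpose] X tA tP
    by (simp add: matrix_transpose_mul block_inverse_def)
  have P_mult: "(P ** B) $ i $ j = (if i \<in> S then B $ i $ j else 0)" for B :: "real ^ 'a ^ 'a" and i j
    by (simp add: P_def matrix_matrix_mult_def if_distrib [where f = "\<lambda>x. x * _"]
        sum.delta' cong: if_cong)
  have "P ** A = A" "P ** X = X"
    using block_inverse_outside[OF X]
    by (auto simp: vec_eq_iff P_mult A_def outer_product_def ind_vec_def)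
  then show ?thesis
    using AX XA tP unfolding is_pseudoinverse_def A_def[symmetric] by simp
qed

lemma Qstar_eqI:
  assumes "block_inverse Q S X" "transpose Q = Q"
  shows "Qstar Q S = X"
  unfolding Qstar_def by (rule pseudoinverse_eqI[OF block_inverse_is_pseudoinverse[OF assms]])

section \<open>The rank one update\<close>

text \<open>Gram-Schmidt in the inner product given by a symmetric positive definite
  \<open>Q\<close>: for a block inverse \<open>X\<close> on \<open>S\<close>, this is e_k minus its
  projection onto the coordinates in \<open>S\<close>.\<close>

definition border_vec :: "real ^ 'n ^ 'n \<Rightarrow> real ^ 'n ^ 'n \<Rightarrow> 'n \<Rightarrow> real ^ 'n" where
  "border_vec Q X k = axis k 1 - X *v column k Q"

definition schur_complement :: "real ^ 'n ^ 'n \<Rightarrow> real ^ 'n ^ 'n \<Rightarrow> 'n \<Rightarrow> real" where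
  "schur_complement Q X k = Q $ k $ k - column k Q \<bullet> (X *v column k Q)"

text \<open>Applying \<open>Q\<close> gives \<open>column k Q - (Q ** X) *v column k Q\<close>, and
  the rows of \<open>Q ** X\<close> in \<open>S\<close> are identity rows.\<close>

lemma Q_mult_border_vec:
  assumes X: "block_inverse Q S X" and sym: "transpose Q = Q"
  shows "i \<in> S \<Longrightarrow> (Q *v border_vec Q X k) $ i = 0"
    and "(Q *v border_vec Q X k) $ k = schur_complement Q X k"
proof -
  have eq: "(Q *v border_vec Q X k) $ i = Q $ i $ k - ((Q ** X) *v column k Q) $ i" for i
    by (simp add: border_vec_def matrix_vector_mult_diff_distrib matrix_vector_mul_assoc
        matrix_vector_mult_basis column_def)
  show "(Q *v border_vec Q X k) $ i = 0" if "i \<in> S"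
    using X that unfolding eq
    by (simp add: block_inverse_def matrix_vector_mult_def[of "Q ** X"] column_def
        if_distrib [where f = "\<lambda>x. x * _"] cong: if_cong)
  have "((Q ** X) *v column k Q) $ k = column k Q \<bullet> (X *v column k Q)"
    unfolding matrix_vector_mul_assoc[symmetric]
    by (simp add: matrix_vector_mult_def[of Q] inner_vec_def column_def symmetric_entry[OF sym, of k])
  then show "(Q *v border_vec Q X k) $ k = schur_complement Q X k"
    by (simp add: eq schur_complement_def)
qed

lemma border_vec_entry:
  assumes X: "block_inverse Q S X" and k: "k \<notin> S"
  shows "border_vec Q X k $ k = 1" and "i \<notin> insert k S \<Longrightarrow> border_vec Q X k $ i = 0"
  using block_inverse_outside[OF X] k
  by (auto simp: border_vec_def matrix_vector_mult_def axis_def)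

text \<open>It is the quadratic form at the border vector v: \<open>Q *v v\<close> vanishes on
  \<open>S\<close>, v vanishes outside \<open>insert k S\<close>, and v_k = 1.\<close>

lemma schur_complement_pos:
  assumes X: "block_inverse Q S X" and k: "k \<notin> S"
    and sym: "transpose Q = Q" and pd: "\<And>x. x \<noteq> 0 \<Longrightarrow> 0 < x \<bullet> (Q *v x)"
  shows "schur_complement Q X k > 0"
proof -
  let ?v = "border_vec Q X k"
  have "?v \<bullet> (Q *v ?v) = (\<Sum>i\<in>UNIV. if i = k then schur_complement Q X k else 0)"
    unfolding inner_vec_def
  proof (rule sum.cong[OF refl])
    fix i
    show "?v $ i \<bullet> (Q *v ?v) $ i = (if i = k then schur_complement Q X k else 0)"
      using border_vec_entry[OF X k] Q_mult_border_vec[OF X sym] k by (cases "i \<in> S") auto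
  qed
  moreover have "?v \<noteq> 0"
    using border_vec_entry(1)[OF X k] by auto
  ultimately show ?thesis
    using pd[of ?v] by simp
qed

text \<open>The update adds (Q v)_i v_j / s to \<open>Q ** X\<close>: nothing in the rows of
  \<open>S\<close>, and v_j in row \<open>k\<close>, exactly what that row lacks by
  \<open>row_k\<close>.\<close>

lemma block_inverse_insert:
  assumes X: "block_inverse Q S X" and k: "k \<notin> S" and sym: "transpose Q = Q"
    and s: "schur_complement Q X k \<noteq> 0"
  shows "block_inverse Q (insert k S)
    (X + (1 / schur_complement Q X k) *\<^sub>R outer_product (border_vec Q X k) (border_vec Q X k))"
    (is "block_inverse _ _ (X + (1 / ?s) *\<^sub>R outer_product ?v ?v)")
proof -
  let ?X = "X + (1 / ?s) *\<^sub>R outer_product ?v ?v"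
  have QX: "(Q ** ?X) $ i $ j = (Q ** X) $ i $ j + (Q *v ?v) $ i * ?v $ j / ?s" for i j
    by (simp add: matrix_matrix_mult_def matrix_vector_mult_def outer_product_def
        distrib_left sum.distrib sum_distrib_right sum_divide_distrib mult.assoc)
  have tX: "transpose X = X"
    using X by (simp add: block_inverse_def)
  have row_k: "(Q ** X) $ k $ j = (if k = j then 1 else 0) - ?v $ j" for j
    by (simp add: border_vec_def matrix_matrix_mult_def matrix_vector_mult_def axis_def column_def
        symmetric_entry[OF sym, of k] symmetric_entry[OF tX, of j] mult.commute)
  have "(Q ** ?X) $ i $ j = (if i = j then 1 else 0)" if "i \<in> insert k S" for i j
  proof (cases "i = k")
    case True
    then show ?thesis
      using s by (simp add: QX row_k Q_mult_border_vec(2)[OF X sym])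
  next
    case False
    then have "i \<in> S" using that by simp
    then show ?thesis
      using X by (simp add: QX Q_mult_border_vec(1)[OF X sym] block_inverse_def)
  qed
  moreover have "transpose ?X = ?X"
    using symmetric_entry[OF tX] by (simp add: transpose_def vec_eq_iff outer_product_def mult.commute)
  moreover have "?X $ i $ j = 0" if "i \<notin> insert k S" for i j
    using that border_vec_entry(2)[OF X k that] block_inverse_outside[OF X, of i]
    by (simp add: outer_product_def)
  ultimately show ?thesis
    by (simp add: block_inverse_def)
qed

lemma block_inverse_empty: "block_inverse Q {} 0"
  by (simp add: block_inverse_def transpose_def vec_eq_iff)

text \<open>Adding the indices of \<open>S\<close> one at a time gives existence; uniqueness of the
  pseudoinverse identifies the result with \<open>Qstar\<close>.\<close>

lemma block_inverse_Qstar: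
  assumes sym: "transpose Q = Q" and pd: "\<And>x. x \<noteq> 0 \<Longrightarrow> 0 < x \<bullet> (Q *v x)"
  shows "block_inverse Q S (Qstar Q S)"
proof -
  have "\<exists>X. block_inverse Q S X"
    using finite[of S]
  proof induction
    case empty
    then show ?case using block_inverse_empty by blast
  next
    case (insert k S)
    then obtain X where X: "block_inverse Q S X" by blast
    then have "schur_complement Q X k \<noteq> 0"
      using schur_complement_pos[OF X insert.hyps(2) sym pd] by simp
    then show ?case
      using block_inverse_insert[OF X insert.hyps(2) sym] by blast
  qed
  then show ?thesis
    using Qstar_eqI[OF _ sym] by blast
qed

section \<open>Supermodularity for Stieltjes matrices\<close>

text \<open>Multiplying by a nonpositive Q_jk reverses X <= Y. The diagonal entry Q_kk only meets
  column \<open>k\<close> of \<open>X\<close> and \<open>Y\<close>, which is zero because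
  \<open>k\<close> lies outside \<open>S\<close> and \<open>T\<close>.\<close>

lemma border_vec_mono:
  assumes X: "block_inverse Q S X" and Y: "block_inverse Q T Y"
    and "k \<notin> S" "k \<notin> T" and XY: "\<And>i j. X $ i $ j \<le> Y $ i $ j"
    and off: "\<And>i j. i \<noteq> j \<Longrightarrow> Q $ i $ j \<le> 0"
  shows "border_vec Q X k $ i \<le> border_vec Q Y k $ i"
proof -
  have "Y $ i $ j * Q $ j $ k \<le> X $ i $ j * Q $ j $ k" for j
    using block_inverse_outside[OF X, of i j] block_inverse_outside[OF Y, of i j] assms(3,4)
      mult_right_mono_neg[OF XY off, of j k i j]
    by (cases "j = k") auto
  then show ?thesis
    by (simp add: border_vec_def matrix_vector_mult_def column_def sum_mono)
qed

text \<open>The sign flips twice: \<open>X *v column k Q\<close> falls off the diagonal index as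
  \<open>X\<close> grows, and pairing it with nonpositive entries makes the subtracted term grow.
  The term i = k is zero on both sides.\<close>

lemma schur_complement_antimono:
  assumes X: "block_inverse Q S X" and Y: "block_inverse Q T Y"
    and "k \<notin> S" "k \<notin> T" and XY: "\<And>i j. X $ i $ j \<le> Y $ i $ j"
    and off: "\<And>i j. i \<noteq> j \<Longrightarrow> Q $ i $ j \<le> 0"
  shows "schur_complement Q Y k \<le> schur_complement Q X k"
proof -
  have "(X *v column k Q) $ i * Q $ i $ k \<le> (Y *v column k Q) $ i * Q $ i $ k" for i
  proof (cases "i = k")
    case True
    then show ?thesis
      using block_inverse_outside[OF X, of i] block_inverse_outside[OF Y, of i] assms(3,4)
      by (simp add: matrix_vector_mult_def)
  next
    case False
    have "(Y *v column k Q) $ i \<le> (X *v column k Q) $ i"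
      using border_vec_mono[OF assms, of i] by (simp add: border_vec_def)
    then show ?thesis
      using off[OF False] by (rule mult_right_mono_neg)
  qed
  then show ?thesis
    by (simp add: schur_complement_def inner_vec_def column_def mult.commute sum_mono)
qed

context
  fixes Q :: "real ^ 'n ^ 'n"
  assumes Q: "stieltjes_matrix Q"
begin

lemma sym_Q: "transpose Q = Q"
  and pos_def_Q: "x \<noteq> 0 \<Longrightarrow> 0 < x \<bullet> (Q *v x)"
  and off_diag_Q: "i \<noteq> j \<Longrightarrow> Q $ i $ j \<le> 0"
  using Q by (auto simp: stieltjes_matrix_def)

lemma Qstar_block_inverse: "block_inverse Q S (Qstar Q S)"
  by (rule block_inverse_Qstar[OF sym_Q pos_def_Q])

lemma Qstar_empty: "Qstar Q {} = 0"
  by (rule Qstar_eqI[OF block_inverse_empty sym_Q])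

lemma schur_complement_Qstar_pos: "k \<notin> S \<Longrightarrow> schur_complement Q (Qstar Q S) k > 0"
  by (rule schur_complement_pos[OF Qstar_block_inverse _ sym_Q pos_def_Q])

lemma R_mat_entry:
  assumes "k \<notin> S"
  shows "R_mat Q k S $ i $ j = border_vec Q (Qstar Q S) k $ i * border_vec Q (Qstar Q S) k $ j
           / schur_complement Q (Qstar Q S) k"
  using Qstar_eqI[OF block_inverse_insert[OF Qstar_block_inverse assms sym_Q] sym_Q]
    schur_complement_Qstar_pos[OF assms]
  by (simp add: R_mat_def outer_product_def)

text \<open>Comparison with the empty set, whose block inverse is 0 and whose border vector is
  e_k.\<close>

lemma border_vec_nonneg:
  assumes "k \<notin> S" "\<And>i j. 0 \<le> Qstar Q S $ i $ j"
  shows "0 \<le> border_vec Q (Qstar Q S) k $ i"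
proof -
  have "border_vec Q 0 k $ i \<le> border_vec Q (Qstar Q S) k $ i"
    by (rule border_vec_mono[OF block_inverse_empty Qstar_block_inverse])
      (use assms off_diag_Q in auto)
  moreover have "0 \<le> border_vec Q 0 k $ i"
    by (simp add: border_vec_def axis_def)
  ultimately show ?thesis by simp
qed

text \<open>Nonnegativity of \<open>Qstar\<close> is a hypothesis here because the induction for
  \<open>Qstar_nonneg\<close> runs through this lemma.\<close>

lemma R_mat_nonneg_if_Qstar_nonneg:
  assumes "k \<notin> S" "\<And>i j. 0 \<le> Qstar Q S $ i $ j"
  shows "0 \<le> R_mat Q k S $ i $ j"
  using border_vec_nonneg[OF assms] schur_complement_Qstar_pos[OF assms(1)]
  by (simp add: R_mat_entry[OF assms(1)])

lemma Qstar_insert: "Qstar Q (insert k S) = Qstar Q S + R_mat Q k S"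
  by (simp add: R_mat_def)

lemma Qstar_nonneg: "0 \<le> Qstar Q S $ i $ j"
  using finite[of S]
proof (induction arbitrary: i j)
  case empty
  then show ?case by (simp add: Qstar_empty)
next
  case (insert k S)
  then show ?case
    using R_mat_nonneg_if_Qstar_nonneg[OF insert.hyps(2) insert.IH]
    by (simp add: Qstar_insert)
qed

lemma Qstar_mono:
  assumes "S \<subseteq> T"
  shows "Qstar Q S $ i $ j \<le> Qstar Q T $ i $ j"
proof -
  \<comment> \<open>The induction adds a set \<open>U\<close> to a fixed \<open>S\<close>;
    \<open>U = T\<close> gives the claim.\<close>
  have "Qstar Q S $ i $ j \<le> Qstar Q (U \<union> S) $ i $ j" for U
    using finite[of U]
  proof induction
    case empty
    then show ?case by simp
  next
    case (insert k U)
    show ?case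
    proof (cases "k \<in> U \<union> S")
      case True
      then show ?thesis using insert.IH by (simp add: insert_absorb)
    next
      case False
      then show ?thesis
        using insert.IH R_mat_nonneg_if_Qstar_nonneg[OF False Qstar_nonneg, of i j]
        by (simp add: Qstar_insert)
    qed
  qed
  from this[of T] show ?thesis
    using assms by (simp add: Un_absorb2)
qed

text \<open>Supermodularity in the form of increasing marginals.\<close>

lemma R_mat_mono:
  assumes "S \<subseteq> T" "k \<notin> T"
  shows "R_mat Q k S \<le> R_mat Q k T"
proof -
  have k: "k \<notin> S" using assms by blast
  let ?v = "\<lambda>S. border_vec Q (Qstar Q S) k" and ?s = "\<lambda>S. schur_complement Q (Qstar Q S) k"
  have v: "?v S $ i \<le> ?v T $ i" for i
    by (rule border_vec_mono[OF Qstar_block_inverse Qstar_block_inverse k assms(2)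
          Qstar_mono[OF assms(1)] off_diag_Q])
  have s: "?s T \<le> ?s S"
    by (rule schur_complement_antimono[OF Qstar_block_inverse Qstar_block_inverse k assms(2)
          Qstar_mono[OF assms(1)] off_diag_Q])
  have nonneg: "0 \<le> ?v S $ i" for i
    by (rule border_vec_nonneg[OF k Qstar_nonneg])
  have "R_mat Q k S $ i $ j \<le> R_mat Q k T $ i $ j" for i j
    unfolding R_mat_entry[OF k] R_mat_entry[OF assms(2)]
    using v[of i] v[of j] nonneg[of i] nonneg[of j] s schur_complement_Qstar_pos[OF assms(2)]
    by (intro frac_le mult_mono mult_nonneg_nonneg) auto
  then show ?thesis
    by (simp add: less_eq_vec_def)
qed

end

section \<open>Orderings of the index set\<close>

lemma prefix_set_0: "prefix_set \<pi> 0 = {}"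
  by (simp add: prefix_set_def)

lemma prefix_set_Suc: "prefix_set \<pi> (Suc m) = insert (\<pi> (Suc m)) (prefix_set \<pi> m)"
  by (auto simp: prefix_set_def atLeastAtMostSuc_conv)

lemma ordering_notin_prefix_set:
  fixes \<pi> :: "nat \<Rightarrow> 'n::finite"
  assumes "is_ordering \<pi>" "Suc m \<le> CARD('n)"
  shows "\<pi> (Suc m) \<notin> prefix_set \<pi> m"
proof
  assume "\<pi> (Suc m) \<in> prefix_set \<pi> m"
  then obtain j where "j \<in> {1..m}" "\<pi> (Suc m) = \<pi> j"
    by (auto simp: prefix_set_def)
  then have "Suc m = j"
    using assms unfolding is_ordering_def bij_betw_def
    by (intro inj_onD[of \<pi> "{1..CARD('n)}"]) auto
  then show False
    using \<open>j \<in> {1..m}\<close> by simp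
qed

lemma prefix_set_CARD:
  fixes \<pi> :: "nat \<Rightarrow> 'n::finite"
  assumes "is_ordering \<pi>"
  shows "prefix_set \<pi> CARD('n) = UNIV"
  using assms by (simp add: is_ordering_def prefix_set_def bij_betw_def)

lemma exists_decreasing_ordering:
  fixes z :: "'n::finite \<Rightarrow> real"
  obtains \<pi> :: "nat \<Rightarrow> 'n" where "is_ordering \<pi>"
    "\<And>k. k \<in> {1..<CARD('n)} \<Longrightarrow> z (\<pi> (Suc k)) \<le> z (\<pi> k)"
proof -
  obtain ys :: "'n list" where ys: "set ys = UNIV" "distinct ys"
    using finite_distinct_list[OF finite] by blast
  \<comment> \<open>\<open>sort_key\<close> sorts upwards, so the negated key makes \<open>z\<close>
    decrease.\<close>
  define xs where "xs = sort_key (\<lambda>i. - z i) ys"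
  have xs: "set xs = UNIV" "distinct xs" "sorted (map (\<lambda>i. - z i) xs)"
    using ys by (auto simp: xs_def)
  then have len: "length xs = CARD('n)"
    by (metis distinct_card)
  \<comment> \<open>Lists are indexed from 0, orderings from 1.\<close>
  have "bij_betw (\<lambda>k. k - 1) {1..CARD('n)} {..<length xs}"
    by (rule bij_betw_byWitness[where f' = Suc]) (auto simp: len)
  moreover have "bij_betw ((!) xs) {..<length xs} UNIV"
    using xs by (intro bij_betw_nth) auto
  ultimately have "is_ordering (\<lambda>k. xs ! (k - 1))"
    using bij_betw_trans unfolding is_ordering_def comp_def by fastforce
  moreover have "z (xs ! (Suc k - 1)) \<le> z (xs ! (k - 1))" if "k \<in> {1..<CARD('n)}" for k
    using sorted_nth_mono[OF xs(3), of "k - 1" k] that by (auto simp: len)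
  ultimately show thesis by (rule that)
qed

text \<open>With \<open>a 0 = 1\<close>, \<open>a (Suc m) = 0\<close> and \<open>a\<close>
  decreasing, the left side is a convex combination of the \<open>g k\<close>.\<close>

lemma abel_summation:
  fixes g :: "nat \<Rightarrow> 'a::real_vector"
  shows "(\<Sum>k\<le>m. (a k - a (Suc k)) *\<^sub>R g k) =
         a 0 *\<^sub>R g 0 + (\<Sum>k = 1..m. a k *\<^sub>R (g k - g (k - 1))) - a (Suc m) *\<^sub>R g m"
  by (induction m) (auto simp: algebra_simps)

section \<open>The convex hull\<close>

lemma mem_P_le_iff:
  "(z, W) \<in> P_le Q \<longleftrightarrow> (\<exists>S. z = ind_vec S \<and> W \<le> Qstar Q S)"
proof -
  have "z = ind_vec {i. z $ i = 1} \<longleftrightarrow> (\<forall>i. z $ i \<in> {0, 1})"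
    by (auto simp: vec_eq_iff ind_vec_def)
  moreover have "\<forall>i. ind_vec S $ i \<in> {0, 1 :: real}" for S :: "'a set"
    by (simp add: ind_vec_def)
  ultimately show ?thesis
    unfolding P_le_def Qstar_def by auto
qed

text \<open>Intersect \<open>S\<close> with growing prefixes. An index of \<open>S\<close> adds its
  marginal at the intersection, which \<open>R_mat_mono\<close> bounds by the marginal at the whole
  prefix; an index outside \<open>S\<close> changes neither side.\<close>

lemma Qstar_le_ordering_sum:
  fixes Q :: "real ^ 'n ^ 'n" and \<pi> :: "nat \<Rightarrow> 'n"
  assumes Q: "stieltjes_matrix Q" and \<pi>: "is_ordering \<pi>"
  shows "Qstar Q S \<le>
    (\<Sum>k = 1..CARD('n). ind_vec S $ \<pi> k *\<^sub>R R_mat Q (\<pi> k) (prefix_set \<pi> (k - 1)))"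
proof -
  have "Qstar Q (S \<inter> prefix_set \<pi> m) \<le>
      (\<Sum>k = 1..m. ind_vec S $ \<pi> k *\<^sub>R R_mat Q (\<pi> k) (prefix_set \<pi> (k - 1)))"
    if "m \<le> CARD('n)" for m
    using that
  proof (induction m)
    case 0
    then show ?case
      by (simp add: prefix_set_0 Qstar_empty[OF Q])
  next
    case (Suc m)
    let ?k = "\<pi> (Suc m)"
    show ?case
    proof (cases "?k \<in> S")
      case True
      have "R_mat Q ?k (S \<inter> prefix_set \<pi> m) \<le> R_mat Q ?k (prefix_set \<pi> m)"
        using ordering_notin_prefix_set[OF \<pi> Suc.prems] by (intro R_mat_mono[OF Q]) auto
      then show ?thesis
        using Suc True by (simp add: prefix_set_Suc Qstar_insert[OF Q] ind_vec_def add_mono)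
    next
      case False
      then show ?thesis
        using Suc by (simp add: prefix_set_Suc ind_vec_def)
    qed
  qed
  from this[OF order_refl] show ?thesis
    by (simp add: prefix_set_CARD[OF \<pi>])
qed

lemma convex_le_linear:
  fixes f :: "'a::real_vector \<Rightarrow> 'b::ordered_real_vector"
  assumes "linear f"
  shows "convex {(z, w). w \<le> f z}"
  unfolding convex_def
  by (auto simp: linear_add[OF assms] linear_cmul[OF assms] intro!: add_mono scaleR_left_mono)

text \<open>Each ordering contributes the region below a linear map of \<open>z\<close>, and the
  bounds contribute a box.\<close>

lemma convex_ordering_polyhedron:
  fixes M :: "(nat \<Rightarrow> 'n::finite) \<Rightarrow> nat \<Rightarrow> real ^ 'm::finite ^ 'l::finite"
  shows "convex {(z :: real ^ 'n, W). (\<forall>\<pi>. A \<pi> \<longrightarrow> W \<le> (\<Sum>k = 1..m. z $ \<pi> k *\<^sub>R M \<pi> k)) \<and>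
      (\<forall>i. 0 \<le> z $ i \<and> z $ i \<le> 1)}"
proof -
  have "linear (\<lambda>z :: real ^ 'n. \<Sum>k = 1..m. z $ \<pi> k *\<^sub>R M \<pi> k)" for \<pi>
    by (auto intro!: linearI simp: scaleR_add_left sum.distrib scaleR_sum_right)
  then have "convex (\<Inter>\<pi>\<in>Collect A. {(z, W). W \<le> (\<Sum>k = 1..m. z $ \<pi> k *\<^sub>R M \<pi> k)})"
    by (intro convex_INT ballI convex_le_linear)
  moreover have "convex ({z. \<forall>i. 0 \<le> z $ i \<and> z $ i \<le> 1} \<times> UNIV :: ((real ^ 'n) \<times> (real ^ 'm ^ 'l)) set)"
    by (intro convex_Times convex_box_cart convex_UNIV)
      (simp flip: atLeastAtMost_iff)
  ultimately have "convex ((\<Inter>\<pi>\<in>Collect A. {(z, W). W \<le> (\<Sum>k = 1..m. z $ \<pi> k *\<^sub>R M \<pi> k)})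
      \<inter> ({z. \<forall>i. 0 \<le> z $ i \<and> z $ i \<le> 1} \<times> UNIV))"
    by (rule convex_Int)
  then show ?thesis
    by (rule back_subst[of convex]) auto
qed

theorem theorem2:
  fixes Q :: "real ^ 'n ^ 'n"
  assumes "stieltjes_matrix Q"
  shows "convex hull (P_le Q) =
    {(z, W). (\<forall>\<pi> :: nat \<Rightarrow> 'n. is_ordering \<pi> \<longrightarrow>
                W \<le> (\<Sum>k = 1..CARD('n). z $ \<pi> k *\<^sub>R R_mat Q (\<pi> k) (prefix_set \<pi> (k - 1)))) \<and>
             (\<forall>i. 0 \<le> z $ i \<and> z $ i \<le> 1)}"
    (is "_ = ?C")
proof
  show "convex hull (P_le Q) \<subseteq> ?C"
  proof (rule hull_minimal)
    show "P_le Q \<subseteq> ?C"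
    proof clarify
      fix z :: "real ^ 'n" and W
      assume "(z, W) \<in> P_le Q"
      then obtain S where S: "z = ind_vec S" "W \<le> Qstar Q S"
        by (auto simp: mem_P_le_iff)
      have "W \<le> (\<Sum>k = 1..CARD('n). z $ \<pi> k *\<^sub>R R_mat Q (\<pi> k) (prefix_set \<pi> (k - 1)))"
        if "is_ordering \<pi>" for \<pi>
        unfolding S(1) by (rule order_trans[OF S(2) Qstar_le_ordering_sum[OF assms that]])
      moreover have "\<forall>i. 0 \<le> z $ i \<and> z $ i \<le> 1"
        by (simp add: S(1) ind_vec_def)
      ultimately show "(\<forall>\<pi>. is_ordering \<pi> \<longrightarrow>
          W \<le> (\<Sum>k = 1..CARD('n). z $ \<pi> k *\<^sub>R R_mat Q (\<pi> k) (prefix_set \<pi> (k - 1)))) \<and>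
          (\<forall>i. 0 \<le> z $ i \<and> z $ i \<le> 1)"
        by blast
    qed
    show "convex ?C"
      by (rule convex_ordering_polyhedron)
  qed
  show "?C \<subseteq> convex hull (P_le Q)"
  proof clarify
    fix z :: "real ^ 'n" and W
    let ?n = "CARD('n)"
    assume ineq: "\<forall>\<pi>. is_ordering \<pi> \<longrightarrow>
        W \<le> (\<Sum>k = 1..?n. z $ \<pi> k *\<^sub>R R_mat Q (\<pi> k) (prefix_set \<pi> (k - 1)))"
      and z: "\<forall>i. 0 \<le> z $ i \<and> z $ i \<le> 1"
    obtain \<pi> where \<pi>: "is_ordering \<pi>"
      and dec: "\<And>k. k \<in> {1..<?n} \<Longrightarrow> z $ \<pi> (Suc k) \<le> z $ \<pi> k"
      using exists_decreasing_ordering[of "($) z"] by blast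
    \<comment> \<open>\<open>D <= 0\<close> by the inequality for the sorted ordering. Shifting all
      prefix points by this one \<open>D\<close> keeps them in \<open>P_le Q\<close> and lets their
      combination hit \<open>W\<close> exactly.\<close>
    define D where
      "D = W - (\<Sum>k = 1..?n. z $ \<pi> k *\<^sub>R R_mat Q (\<pi> k) (prefix_set \<pi> (k - 1)))"
    \<comment> \<open>The sorted values padded by 1 in front and 0 behind: the bounds on
      \<open>z\<close> keep the sequence decreasing, and its differences sum to 1.\<close>
    define a where "a k = (if k = 0 then 1 else if k \<le> ?n then z $ \<pi> k else 0)" for k
    define g where "g k = (ind_vec (prefix_set \<pi> k) :: real ^ 'n, Qstar Q (prefix_set \<pi> k) + D)" for k
    have a_dec: "a (Suc k) \<le> a k" for k
      using z dec[of k] by (auto simp: a_def)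
    have g_mem: "g k \<in> P_le Q" for k
      using ineq \<pi> by (auto simp: g_def mem_P_le_iff D_def)
    \<comment> \<open>The common shift \<open>D\<close> cancels.\<close>
    have g_diff: "g k - g (k - 1) = (axis (\<pi> k) 1, R_mat Q (\<pi> k) (prefix_set \<pi> (k - 1)))"
      if "k \<in> {1..?n}" for k
    proof -
      obtain m where k: "k = Suc m" using \<open>k \<in> {1..?n}\<close> by (cases k) auto
      show ?thesis
        using ordering_notin_prefix_set[OF \<pi>, of m] that
        by (auto simp: k g_def prefix_set_Suc R_mat_def ind_vec_def vec_eq_iff axis_def)
    qed
    have z_sum: "(\<Sum>k = 1..?n. z $ \<pi> k *\<^sub>R axis (\<pi> k) 1) = z"
    proof -
      have "(\<Sum>k = 1..?n. z $ \<pi> k *\<^sub>R axis (\<pi> k) 1) = (\<Sum>i\<in>UNIV. z $ i *\<^sub>R axis i (1::real))"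
        using \<pi> unfolding is_ordering_def by (rule sum.reindex_bij_betw)
      also have "\<dots> = z"
        using basis_expansion[of z] by (simp add: scalar_mult_eq_scaleR)
      finally show ?thesis .
    qed
    have "(\<Sum>k\<le>?n. (a k - a (Suc k)) *\<^sub>R g k) = g 0 + (\<Sum>k = 1..?n. a k *\<^sub>R (g k - g (k - 1)))"
      by (simp add: abel_summation) (simp add: a_def)
    also have "\<dots> = g 0 + (\<Sum>k = 1..?n.
        (z $ \<pi> k *\<^sub>R axis (\<pi> k) 1, z $ \<pi> k *\<^sub>R R_mat Q (\<pi> k) (prefix_set \<pi> (k - 1))))"
      by (intro arg_cong2[of _ _ _ _ "(+)"] refl sum.cong) (subst g_diff, auto simp: a_def)
    \<comment> \<open>Since \<open>g 0 = (0, D)\<close>, the first summand supplies the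
      \<open>D\<close> that completes the second component to \<open>W\<close>.\<close>
    also have "\<dots> = (z, W)"
      by (simp add: sum_prod z_sum g_def D_def prefix_set_0 Qstar_empty[OF assms] ind_vec_def
          zero_vec_def[symmetric] del: One_nat_def)
    finally have "(\<Sum>k\<le>?n. (a k - a (Suc k)) *\<^sub>R g k) = (z, W)" .
    moreover have "(\<Sum>k\<le>?n. (a k - a (Suc k)) *\<^sub>R g k) \<in> convex hull (P_le Q)"
    proof (rule convex_sum)
      show "(\<Sum>k\<le>?n. a k - a (Suc k)) = 1"
        by (simp add: sum_telescope) (simp add: a_def)
    qed (use a_dec g_mem in \<open>auto intro: hull_inc\<close>)
    ultimately show "(z, W) \<in> convex hull (P_le Q)"
      by simp
  qed
qed

end
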